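(* Let $n,q$ be positive integers. For every $\pi\in S_{n+q-1}$: (1) $Del_q(\pi)-q+1=Del_1(f_q(\pi))$, and in particular $del_q(\pi)=del_1(f_q(\pi))$; (2) $Des_q(\pi)-q+1=Des_1(f_q(\pi))$, and in particular $des_q(\pi)=des_1(f_q(\pi))$; (3) $inv_q(\pi)=inv_1(f_q(\pi))=\ell_q(\pi)=\ell_1(f_q(\pi))$.
   Context: For a set $D$ of integers and an integer $r$, $D-r=\{i-r\mid i\in D\}$ (so $D-q+1=\{i-q+1\mid i\in D\}$). Permutations are multiplied as functions: $(\sigma\tau)(i)=\sigma(\tau(i))$; $s_i=(i,i+1)$. Canonical presentation in $S_m$: for $1\le j\le m-1$ let $R_j=\{1,\ s_j,\ s_js_{j-1},\ \ldots,\ s_js_{j-1}\cdots s_1\}$. Every $w\in S_m$ can be written uniquely as $w=w_1\cdots w_{m-1}$ with $w_j\in R_j$; this product, regarded as a word in the $s_i$ (each $w_j$ being spelled as displayed), is the canonical presentation of $w$. The map $f_q:S_{n+q-1}\to S_n$: if $\pi=s_{i_1}\cdots s_{i_r}$ is the canonical presentation of $\pi$, then $f_q(\pi)=f_q(s_{i_1})\cdots f_q(s_{i_r})$, where $f_q(s_1)=\cdots=f_q(s_{q-1})=1$ and $f_q(s_j)=s_{j-q+1}$ for $j\ge q$. For any positive integer $p$ and $\pi\in S_m$ with $m\ge p$ (used here with $p=q$, $m=n+q-1$ and with $p=1$, $m=n$): - $\ell_p(\pi)$ is the number of letters $s_i$ with $i\ge p$ in the canonical presentation of $\pi$ (with multiplicity);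 - $inv_p(\pi)=\sum_{i=p+1}^m \min\{\,i-p,\ \#\{j<i\mid \pi(j)>\pi(i)\}\,\}$; - $del_p(\pi)$ is the number of times $s_p$ appears in the canonical presentation of $\pi$; - $Del_p(\pi)=\{ i \mid p+1\le i\le m,\ \#\{j<i\mid \pi(j)<\pi(i)\}\le p-1\}$; - $Des_p(\pi)$ is the set of $i$ with $p\le i\le m-1$ such that $\pi(i)>\pi(i+1)$ or $i+1\in Del_p(\pi)$ (or both), and $des_p(\pi)=\#Des_p(\pi)$. *)

theory Defs
  imports "HOL-Combinatorics.Permutations"
begin

text \<open>The symmetric group \<open>S\<^sub>m\<close> is \<open>{\<pi>. \<pi> permutes {1..m}}\<close>, with multiplication \<open>(\<circ>)\<close>.
  A word in the generators \<open>s\<^sub>i\<close> is the list of its indices.\<close>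

definition adj :: "nat \<Rightarrow> nat \<Rightarrow> nat" where
  "adj i = Transposition.transpose i (i + 1)"

definition perm_prod :: "(nat \<Rightarrow> nat) list \<Rightarrow> nat \<Rightarrow> nat" where
  "perm_prod fs = foldr (\<circ>) fs id"

text \<open>The words spelling the elements of \<open>R\<^sub>j\<close>; \<open>rev [k..<j + 1]\<close> is \<open>[j, j - 1, \<dots>, k]\<close>.\<close>

definition R_words :: "nat \<Rightarrow> nat list set" where
  "R_words j = insert [] {rev [k..<j + 1] | k. 1 \<le> k \<and> k \<le> j}"

text \<open>\<open>ws\<close> lists the factors \<open>w\<^sub>1, \<dots>, w\<^bsub>m-1\<^esub>\<close> of \<open>\<pi>\<close>; the factor \<open>w\<^sub>j\<close> is at position \<open>j - 1\<close>.\<close>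

definition canonical_factors :: "nat \<Rightarrow> (nat \<Rightarrow> nat) \<Rightarrow> nat list list \<Rightarrow> bool" where
  "canonical_factors m \<pi> ws \<longleftrightarrow>
     length ws = m - 1 \<and> (\<forall>j\<in>{1..m - 1}. ws ! (j - 1) \<in> R_words j) \<and>
     perm_prod (map adj (concat ws)) = \<pi>"

definition canonical_presentation :: "nat \<Rightarrow> (nat \<Rightarrow> nat) \<Rightarrow> nat list" where
  "canonical_presentation m \<pi> = concat (THE ws. canonical_factors m \<pi> ws)"

text \<open>Existence and uniqueness of the canonical presentation, which make the definite description
  above meaningful.\<close>

lemma perm_prod_simps [simp]:
  "perm_prod [] = id" "perm_prod (f # fs) = f \<circ> perm_prod fs"
  by (simp_all add: perm_prod_def)

lemma perm_prod_append: "perm_prod (fs @ gs) = perm_prod fs \<circ> perm_prod gs"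
  by (induction fs) (simp_all add: o_assoc)

lemma perm_prod_permutes:
  "(\<And>f. f \<in> set fs \<Longrightarrow> f permutes A) \<Longrightarrow> perm_prod fs permutes A"
  by (induction fs) (auto simp: permutes_id intro: permutes_compose)

lemma adj_permutes: "1 \<le> i \<Longrightarrow> i < m \<Longrightarrow> adj i permutes {1..m}"
  by (auto simp: adj_def intro!: permutes_swap_id)

lemma R_words_altdef: "R_words j = {rev [k..<j + 1] | k. 1 \<le> k \<and> k \<le> j + 1}"
proof -
  have "{rev [k..<j + 1] | k. 1 \<le> k \<and> k \<le> j + 1} = (\<lambda>k. rev [k..<j + 1]) ` {1..j + 1}"
    by auto
  also have "{1..j + 1} = insert (j + 1) {1..j}" by auto
  finally show ?thesis unfolding R_words_def by (auto simp del: upt_Suc)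
qed

lemma set_R_words: "w \<in> R_words j \<Longrightarrow> set w \<subseteq> {1..j}"
  by (auto simp: R_words_def)

lemma perm_prod_down:
  assumes "1 \<le> k" "k \<le> j + 1"
  shows "perm_prod (map adj (rev [k..<j + 1])) i =
    (if i = k then j + 1 else if k < i \<and> i \<le> j + 1 then i - 1 else i)"
  using assms(2)
proof (induction j)
  case 0
  with assms(1) have "k = 1" by simp
  then show ?case by simp
next
  case (Suc j)
  show ?case
  proof (cases "k = Suc j + 1")
    case True
    then show ?thesis by simp
  next
    case False
    with Suc.prems have k: "k \<le> j + 1" by simp
    then have eq: "rev [k..<Suc j + 1] = (j + 1) # rev [k..<j + 1]" by simp
    have "perm_prod (map adj (rev [k..<Suc j + 1])) i =
        adj (j + 1) (perm_prod (map adj (rev [k..<j + 1])) i)"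
      unfolding eq by simp
    also have "\<dots> = adj (j + 1)
        (if i = k then j + 1 else if k < i \<and> i \<le> j + 1 then i - 1 else i)"
      by (simp only: Suc.IH[OF k])
    also have "\<dots> = (if i = k then Suc j + 1 else if k < i \<and> i \<le> Suc j + 1 then i - 1 else i)"
      using k by (auto simp: adj_def Transposition.transpose_def)
    finally show ?thesis .
  qed
qed

lemma canonical_factors_permutes:
  assumes "canonical_factors m \<pi> ws"
  shows "\<pi> permutes {1..m}"
proof -
  have "adj i permutes {1..m}" if "i \<in> set (concat ws)" for i
  proof -
    from that obtain w where w: "w \<in> set ws" "i \<in> set w" by auto
    then obtain a where a: "a < length ws" "ws ! a = w" by (auto simp: in_set_conv_nth)
    with assms have l: "a < m - 1" by (simp add: canonical_factors_def)
    then have "a + 1 \<in> {1..m - 1}" by simp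
    with assms have "ws ! (a + 1 - 1) \<in> R_words (a + 1)" unfolding canonical_factors_def by blast
    with a w have "i \<in> {1..a + 1}" using set_R_words by fastforce
    with l show ?thesis by (intro adj_permutes) auto
  qed
  then have "perm_prod (map adj (concat ws)) permutes {1..m}"
    by (intro perm_prod_permutes) (auto simp del: map_concat)
  with assms show ?thesis by (simp add: canonical_factors_def)
qed

lemma canonical_factors_snoc:
  assumes "1 \<le> m"
  shows "canonical_factors (m + 1) \<pi> (us @ [w]) \<longleftrightarrow>
    (\<exists>\<sigma>. canonical_factors m \<sigma> us \<and> w \<in> R_words m \<and> \<pi> = \<sigma> \<circ> perm_prod (map adj w))"
proof -
  have "(\<forall>j\<in>{1..m}. (us @ [w]) ! (j - 1) \<in> R_words j) \<longleftrightarrow>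
      (\<forall>j\<in>{1..m - 1}. us ! (j - 1) \<in> R_words j) \<and> w \<in> R_words m" if "length us = m - 1"
  proof -
    have "{1..m} = insert m {1..m - 1}" using assms by auto
    moreover have "(us @ [w]) ! (m - 1) = w" using that by (simp add: nth_append)
    moreover have "(us @ [w]) ! (j - 1) = us ! (j - 1)" if "j \<in> {1..m - 1}" for j
      using that \<open>length us = m - 1\<close> by (auto simp: nth_append)
    ultimately show ?thesis by auto
  qed
  then show ?thesis using assms
    by (auto simp: canonical_factors_def perm_prod_append)
qed

lemma canonical_factors_ex1:
  assumes "\<pi> permutes {1..m}"
  shows "\<exists>!ws. canonical_factors m \<pi> ws"
  using assms
proof (induction m arbitrary: \<pi>)
  case 0
  then show ?case by (auto simp: canonical_factors_def id_def)
next
  case (Suc m)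
  show ?case
  proof (cases "m = 0")
    case True
    with Suc.prems have "\<pi> permutes {1}" by simp
    then have "\<pi> = id" by (simp add: permutes_sing)
    with True show ?thesis by (auto simp: canonical_factors_def id_def)
  next
    case False
    then have m: "1 \<le> m" by simp
    define P where "P k = perm_prod (map adj (rev [k..<m + 1]))" for k
    have P_apply: "P k i = (if i = k then m + 1 else if k < i \<and> i \<le> m + 1 then i - 1 else i)"
      if "1 \<le> k" "k \<le> m + 1" for k i
      unfolding P_def by (rule perm_prod_down[OF that])
    have P_perm: "P k permutes {1..Suc m}" if "1 \<le> k" for k
      unfolding P_def using that by (intro perm_prod_permutes) (auto intro!: adj_permutes[unfolded One_nat_def])
    define k where "k = inv \<pi> (m + 1)"
    have k_in: "k \<in> {1..Suc m}" and \<pi>k: "\<pi> k = m + 1"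
      using permutes_in_image[OF permutes_inv[OF Suc.prems], of "m + 1"]
        permutes_inverses(1)[OF Suc.prems] by (auto simp: k_def)
    then have k: "1 \<le> k" "k \<le> m + 1" by auto
    define \<sigma> where "\<sigma> = \<pi> \<circ> inv (P k)"
    have invP: "inv (P k) (m + 1) = k"
      using P_perm[OF k(1)] P_apply[OF k, of k] permutes_inv_eq by fastforce
    have "\<sigma> permutes {1..Suc m}" unfolding \<sigma>_def
      by (intro permutes_compose permutes_inv P_perm k Suc.prems)
    moreover have "\<sigma> (Suc m) = Suc m" using invP \<pi>k by (simp add: \<sigma>_def)
    moreover have "x \<notin> {1..Suc m} \<or> x = Suc m" if "x \<notin> {1..m}" for x
      using that by auto
    ultimately have "\<sigma> permutes {1..m}"
      unfolding permutes_def by blast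
    from Suc.IH[OF this] obtain us where us: "canonical_factors m \<sigma> us"
      and us_unique: "\<And>vs. canonical_factors m \<sigma> vs \<Longrightarrow> vs = us" by blast
    have "\<pi> = \<sigma> \<circ> P k"
      using permutes_inv_o(2)[OF P_perm[OF k(1)]] by (simp add: \<sigma>_def o_assoc[symmetric])
    moreover have "rev [k..<m + 1] \<in> R_words m" using k unfolding R_words_altdef by blast
    ultimately have ex: "canonical_factors (m + 1) \<pi> (us @ [rev [k..<m + 1]])"
      using us canonical_factors_snoc[OF m] unfolding P_def by blast
    have "ws = us @ [rev [k..<m + 1]]" if ws: "canonical_factors (m + 1) \<pi> ws" for ws
    proof -
      have "length ws = m" using ws by (simp add: canonical_factors_def)
      with m obtain vs v where vs: "ws = vs @ [v]" by (cases ws rule: rev_cases) auto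
      with ws obtain \<tau> where \<tau>: "canonical_factors m \<tau> vs" "v \<in> R_words m"
        "\<pi> = \<tau> \<circ> perm_prod (map adj v)" using canonical_factors_snoc[OF m] by blast
      then obtain l where l: "1 \<le> l" "l \<le> m + 1" "v = rev [l..<m + 1]"
        unfolding R_words_altdef by blast
      then have \<pi>: "\<pi> = \<tau> \<circ> P l" using \<tau>(3) by (simp only: P_def)
      have "\<tau> (m + 1) = m + 1"
        using canonical_factors_permutes[OF \<tau>(1)] by (auto simp: permutes_def)
      then have "\<pi> l = m + 1" using P_apply[OF l(1,2), of l] \<pi> by simp
      with \<pi>k have lk: "l = k" using permutes_inj[OF Suc.prems] by (metis injD)
      have "\<sigma> = \<tau>"
        using permutes_inv_o(1)[OF P_perm[OF k(1)]] \<pi> lk by (simp add: \<sigma>_def o_assoc[symmetric])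
      with \<tau>(1) us_unique vs l(3) lk show ?thesis by simp
    qed
    with ex show ?thesis by (metis Suc_eq_plus1)
  qed
qed

lemma canonical_presentation_ex:
  assumes "\<pi> permutes {1..m}"
  shows "\<exists>ws. canonical_factors m \<pi> ws \<and> canonical_presentation m \<pi> = concat ws"
  using theI'[OF canonical_factors_ex1[OF assms]] by (auto simp: canonical_presentation_def)

lemma canonical_presentation_range:
  assumes "\<pi> permutes {1..m}"
  shows "set (canonical_presentation m \<pi>) \<subseteq> {1..m - 1}"
proof -
  obtain ws where ws: "canonical_factors m \<pi> ws" "canonical_presentation m \<pi> = concat ws"
    using canonical_presentation_ex[OF assms] by blast
  have "set w \<subseteq> {1..m - 1}" if "w \<in> set ws" for w
  proof -
    from that obtain a where a: "a < length ws" "ws ! a = w" by (auto simp: in_set_conv_nth)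
    with ws have l: "a + 1 \<in> {1..m - 1}" by (simp add: canonical_factors_def)
    with ws(1) have "ws ! (a + 1 - 1) \<in> R_words (a + 1)" unfolding canonical_factors_def by blast
    with a l show ?thesis using set_R_words by fastforce
  qed
  with ws(2) show ?thesis by auto
qed

text \<open>\<open>f_map q m\<close> is \<open>f\<^sub>q\<close> on \<open>S\<^sub>m\<close>, where \<open>m = n + q - 1\<close>.\<close>

definition f_gen :: "nat \<Rightarrow> nat \<Rightarrow> nat \<Rightarrow> nat" where
  "f_gen q j = (if j < q then id else adj (j - q + 1))"

definition f_map :: "nat \<Rightarrow> nat \<Rightarrow> (nat \<Rightarrow> nat) \<Rightarrow> nat \<Rightarrow> nat" where
  "f_map q m \<pi> = perm_prod (map (f_gen q) (canonical_presentation m \<pi>))"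

lemma f_map_permutes:
  assumes "\<pi> permutes {1..n + q - 1}" "1 \<le> n" "1 \<le> q"
  shows "f_map q (n + q - 1) \<pi> permutes {1..n}"
proof -
  have "f_gen q j permutes {1..n}" if "j \<in> set (canonical_presentation (n + q - 1) \<pi>)" for j
  proof -
    have "j \<le> n + q - 2" using canonical_presentation_range[OF assms(1)] that by fastforce
    with assms show ?thesis
      by (auto simp: f_gen_def permutes_id intro!: adj_permutes[unfolded One_nat_def])
  qed
  then show ?thesis unfolding f_map_def by (intro perm_prod_permutes) auto
qed

text \<open>Statistics of \<open>\<pi> \<in> S\<^sub>m\<close>, for \<open>1 \<le> p \<le> m\<close>.\<close>

definition ell :: "nat \<Rightarrow> nat \<Rightarrow> (nat \<Rightarrow> nat) \<Rightarrow> nat" where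
  "ell p m \<pi> = length (filter (\<lambda>i. p \<le> i) (canonical_presentation m \<pi>))"

definition inv_stat :: "nat \<Rightarrow> nat \<Rightarrow> (nat \<Rightarrow> nat) \<Rightarrow> nat" where
  "inv_stat p m \<pi> = (\<Sum>i = p + 1..m. min (i - p) (card {j. 1 \<le> j \<and> j < i \<and> \<pi> j > \<pi> i}))"

definition del :: "nat \<Rightarrow> nat \<Rightarrow> (nat \<Rightarrow> nat) \<Rightarrow> nat" where
  "del p m \<pi> = count_list (canonical_presentation m \<pi>) p"

definition Del :: "nat \<Rightarrow> nat \<Rightarrow> (nat \<Rightarrow> nat) \<Rightarrow> nat set" where
  "Del p m \<pi> = {i. p + 1 \<le> i \<and> i \<le> m \<and> card {j. 1 \<le> j \<and> j < i \<and> \<pi> j < \<pi> i} \<le> p - 1}"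

definition Des :: "nat \<Rightarrow> nat \<Rightarrow> (nat \<Rightarrow> nat) \<Rightarrow> nat set" where
  "Des p m \<pi> = {i. p \<le> i \<and> i \<le> m - 1 \<and> (\<pi> i > \<pi> (i + 1) \<or> i + 1 \<in> Del p m \<pi>)}"

definition des :: "nat \<Rightarrow> nat \<Rightarrow> (nat \<Rightarrow> nat) \<Rightarrow> nat" where
  "des p m \<pi> = card (Des p m \<pi>)"

text \<open>The integer set \<open>D - r\<close>, for a set \<open>D\<close> of natural numbers.\<close>

definition shift_set :: "nat set \<Rightarrow> int \<Rightarrow> int set" where
  "shift_set D r = {int i - r | i. i \<in> D}"

end

theory Submission
  imports Defs
begin

text \<open>
  Everything is governed by the left inversion numbers
  \<open>c\<^sub>i(\<pi>) = #{j < i | \<pi>(j) > \<pi>(i)}\<close> and their truncations \<open>min (i - p) c\<^sub>i(\<pi>)\<close>. The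
  sum of the truncated numbers is \<open>inv\<^sub>p\<close>; the positions where the truncation bound is reached form
  \<open>Del\<^sub>p\<close> (lemma \<open>Del_eq_code\<close>), because \<open>i - 1 - c\<^sub>i\<close> counts the smaller entries to the left; and the
  ascents of the truncated sequence form \<open>Des\<^sub>p\<close> (lemma \<open>Des_eq_code\<close>). For \<open>p = 1\<close> the truncation is
  vacuous. So the claims about \<open>Del\<close>, \<open>Des\<close> and \<open>inv\<close> all follow from
  \<open>c\<^sub>i(f\<^sub>q(\<pi>)) = min (i - 1) c\<^bsub>i+q-1\<^esub>(\<pi>)\<close>.

  This identity is proved by induction on the size of the symmetric group. Right multiplication of
  \<open>\<sigma> \<in> S\<^sub>m\<close> by the factor \<open>s\<^sub>m s\<^bsub>m-1\<^esub> \<cdots> s\<^sub>k\<close> inserts the new maximum \<open>m + 1\<close> at position \<open>k\<close> of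
  the one-line notation of \<open>\<sigma>\<close>. The inversion numbers to the left of position \<open>k\<close> are kept, a \<open>0\<close> is
  inserted at \<open>k\<close>, and the later ones move one place to the right and grow by \<open>1\<close>
  (lemma \<open>larger_before_insert_max\<close>). Under \<open>f\<^sub>q\<close> the same step becomes insertion at position
  \<open>max k q - q + 1\<close> (lemma \<open>f_map_insert_max\<close>), and truncation is compatible with the recursion since
  \<open>min (i - q) (c + 1) = min (i - 1 - q) c + 1\<close> for \<open>i > q\<close>.

  The same induction shows that deleting the letters below \<open>q\<close> from the canonical word of \<open>\<pi>\<close> and
  lowering the others by \<open>q - 1\<close> gives the canonical word of \<open>f\<^sub>q(\<pi>)\<close>, hence the claims about \<open>del\<close>
  and \<open>\<ell>\<close>. Finally, an insertion at position \<open>k\<close> adds \<open>m + 1 - k\<close> both to the sum of the \<open>c\<^sub>i\<close> and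
  to the length of the canonical word, so that \<open>inv\<^sub>1 = \<ell>\<^sub>1\<close>.
\<close>

section \<open>Canonical presentations by insertion of the maximum\<close>

text \<open>The product with the \<open>m\<close>-th canonical factor. Since that factor is a cycle, the one-line notation
  of the result is the one of \<open>\<sigma>\<close> with \<open>m + 1\<close> inserted at position \<open>k\<close>.\<close>

definition insert_max :: "nat \<Rightarrow> nat \<Rightarrow> (nat \<Rightarrow> nat) \<Rightarrow> nat \<Rightarrow> nat" where
  "insert_max m k \<sigma> = \<sigma> \<circ> perm_prod (map adj (rev [k..<m + 1]))"

lemma insert_max_apply:
  assumes "\<sigma> permutes {1..m}" "1 \<le> k" "k \<le> m + 1" "1 \<le> i" "i \<le> m + 1"
  shows "insert_max m k \<sigma> i = (if i < k then \<sigma> i else if i = k then m + 1 else \<sigma> (i - 1))"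
proof -
  have "\<sigma> (m + 1) = m + 1"
    using assms(1) by (auto simp: permutes_def)
  then show ?thesis
    unfolding insert_max_def o_apply perm_prod_down[OF assms(2,3)] using assms(4,5) by simp
qed

lemma canonical_presentation_eqI:
  assumes "canonical_factors m \<pi> ws"
  shows "canonical_presentation m \<pi> = concat ws"
  using assms canonical_factors_ex1[OF canonical_factors_permutes[OF assms]]
    the1_equality[of "canonical_factors m \<pi>" ws]
  by (simp add: canonical_presentation_def)

lemma canonical_presentation_trivial:
  assumes "m \<le> 1"
  shows "canonical_presentation m id = []"
  using canonical_presentation_eqI[of m id "[]"] assms by (auto simp: canonical_factors_def)

lemma permutes_le_1:
  fixes m :: nat
  assumes "\<pi> permutes {1..m}" "m \<le> 1"
  shows "\<pi> = id"
proof -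
  have "m = 0 \<or> m = 1" using assms(2) by linarith
  with assms(1) show ?thesis by (auto simp: permutes_sing)
qed

lemma insert_max_permutes_presentation:
  assumes "\<sigma> permutes {1..m}" "1 \<le> k" "k \<le> m + 1"
  shows "insert_max m k \<sigma> permutes {1..m + 1}"
    and "canonical_presentation (m + 1) (insert_max m k \<sigma>) =
      canonical_presentation m \<sigma> @ rev [k..<m + 1]"
proof -
  have "insert_max m k \<sigma> permutes {1..m + 1} \<and>
    canonical_presentation (m + 1) (insert_max m k \<sigma>) =
      canonical_presentation m \<sigma> @ rev [k..<m + 1]"
  proof (cases "m = 0")
    case True
    then have "k = 1" "\<sigma> = id"
      using assms permutes_le_1[OF assms(1)] by auto
    with True have "insert_max m k \<sigma> = id"
      by (simp add: insert_max_def)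
    with True \<open>k = 1\<close> \<open>\<sigma> = id\<close> show ?thesis
      using canonical_presentation_trivial[of 0] canonical_presentation_trivial[of 1]
        permutes_id[of "{1..m + 1}"] by simp
  next
    case False
    obtain us where us: "canonical_factors m \<sigma> us" "canonical_presentation m \<sigma> = concat us"
      using canonical_presentation_ex[OF assms(1)] by blast
    have "rev [k..<m + 1] \<in> R_words m"
      using assms unfolding R_words_altdef by blast
    then have fac: "canonical_factors (m + 1) (insert_max m k \<sigma>) (us @ [rev [k..<m + 1]])"
      using us(1) False canonical_factors_snoc[of m] unfolding insert_max_def by auto
    show ?thesis
      using canonical_factors_permutes[OF fac] canonical_presentation_eqI[OF fac] us(2)
      by (simp del: upt_Suc)
  qed
  then show "insert_max m k \<sigma> permutes {1..m + 1}"
    and "canonical_presentation (m + 1) (insert_max m k \<sigma>) =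
      canonical_presentation m \<sigma> @ rev [k..<m + 1]" by auto
qed

lemma insert_max_cases:
  assumes "\<pi> permutes {1..m + 1}"
  obtains \<sigma> k where "\<sigma> permutes {1..m}" "1 \<le> k" "k \<le> m + 1" "\<pi> = insert_max m k \<sigma>"
proof (cases "m = 0")
  case True
  then have "\<pi> = id"
    using assms permutes_le_1 by auto
  with True show ?thesis
    by (intro that[of id 1]) (auto simp: insert_max_def permutes_id)
next
  case False
  obtain ws where ws: "canonical_factors (m + 1) \<pi> ws"
    using canonical_presentation_ex[OF assms] by blast
  then have "length ws = m"
    by (simp add: canonical_factors_def)
  with False obtain us w where "ws = us @ [w]"
    by (cases ws rule: rev_cases) auto
  with ws False obtain \<sigma> where \<sigma>: "canonical_factors m \<sigma> us" "w \<in> R_words m"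
      "\<pi> = \<sigma> \<circ> perm_prod (map adj w)"
    using canonical_factors_snoc[of m] by auto
  then obtain k where "1 \<le> k" "k \<le> m + 1" "w = rev [k..<m + 1]"
    unfolding R_words_altdef by blast
  with \<sigma> show ?thesis
    by (intro that[of \<sigma> k] canonical_factors_permutes[OF \<sigma>(1)]) (simp_all add: insert_max_def)
qed

section \<open>Left inversion numbers\<close>

definition larger_before :: "(nat \<Rightarrow> nat) \<Rightarrow> nat \<Rightarrow> nat" where
  "larger_before \<pi> i = card {j. 1 \<le> j \<and> j < i \<and> \<pi> j > \<pi> i}"

lemma larger_before_le: "larger_before \<pi> i \<le> i - 1"
proof -
  have "larger_before \<pi> i \<le> card {1..<i}"
    unfolding larger_before_def by (intro card_mono) auto
  then show ?thesis by simp
qed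

text \<open>The new entry exceeds all others, so it has nothing larger to its left and adds one inversion to
  each position on its right.\<close>

lemma larger_before_insert_max:
  assumes "\<sigma> permutes {1..m}" "1 \<le> k" "k \<le> m + 1" "1 \<le> i" "i \<le> m + 1"
  shows "larger_before (insert_max m k \<sigma>) i =
    (if i < k then larger_before \<sigma> i else if i = k then 0 else larger_before \<sigma> (i - 1) + 1)"
proof -
  note app = insert_max_apply[OF assms(1-3)]
  have le: "\<sigma> j \<le> m" if "1 \<le> j" "j \<le> m" for j
    using permutes_in_image[OF assms(1), of j] that by auto
  consider "i < k" | "i = k" | "k < i" by linarith
  then show ?thesis
  proof cases
    case 1
    then have "{j. 1 \<le> j \<and> j < i \<and> insert_max m k \<sigma> j > insert_max m k \<sigma> i} =
        {j. 1 \<le> j \<and> j < i \<and> \<sigma> j > \<sigma> i}"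
      using app assms by auto
    with 1 show ?thesis by (simp add: larger_before_def)
  next
    case 2
    have "insert_max m k \<sigma> j \<le> m" if "1 \<le> j" "j < k" for j
      using app[of j] le[of j] that assms by simp
    moreover have "insert_max m k \<sigma> k = m + 1"
      using app[of k] assms by simp
    ultimately have "{j. 1 \<le> j \<and> j < k \<and> insert_max m k \<sigma> j > insert_max m k \<sigma> k} = {}"
      by fastforce
    with 2 show ?thesis by (simp add: larger_before_def)
  next
    case 3
    \<comment> \<open>The position in the one-line notation after the insertion of the entry formerly at \<open>j\<close>.\<close>
    define h where "h j = (if j < k then j else j + 1)" for j :: nat
    let ?A = "{j. 1 \<le> j \<and> j < i - 1 \<and> \<sigma> j > \<sigma> (i - 1)}"
    have vi: "insert_max m k \<sigma> i = \<sigma> (i - 1)" and vk: "insert_max m k \<sigma> k = m + 1"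
      using app 3 assms by auto
    have vh: "insert_max m k \<sigma> (h j) = \<sigma> j" if "1 \<le> j" "j \<le> m" for j
      using app[of "h j"] that by (auto simp: h_def)
    have "\<sigma> (i - 1) < m + 1"
      using le[of "i - 1"] 3 assms(2,5) by (simp add: le_imp_less_Suc)
    have "{j. 1 \<le> j \<and> j < i \<and> insert_max m k \<sigma> j > insert_max m k \<sigma> i} = insert k (h ` ?A)"
    proof (intro equalityI subsetI)
      fix j assume j: "j \<in> {j. 1 \<le> j \<and> j < i \<and> insert_max m k \<sigma> j > insert_max m k \<sigma> i}"
      show "j \<in> insert k (h ` ?A)"
      proof (cases "j = k")
        case False
        define l where "l = (if j < k then j else j - 1)"
        have "h l = j" "1 \<le> l" "l < i - 1"
          using False j 3 assms by (auto simp: h_def l_def)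
        moreover from this have "\<sigma> l > \<sigma> (i - 1)"
          using vh[of l] vi j assms by auto
        ultimately show ?thesis by blast
      qed simp
    next
      fix j assume "j \<in> insert k (h ` ?A)"
      then consider "j = k" | l where "l \<in> ?A" "j = h l" by blast
      then show "j \<in> {j. 1 \<le> j \<and> j < i \<and> insert_max m k \<sigma> j > insert_max m k \<sigma> i}"
      proof cases
        case 1
        with vi vk \<open>\<sigma> (i - 1) < m + 1\<close> 3 assms show ?thesis by simp
      next
        case 2
        then have "1 \<le> j" "j < i" by (auto simp: h_def)
        moreover from 2 assms have "insert_max m k \<sigma> j = \<sigma> l" using vh[of l] by auto
        ultimately show ?thesis using 2 vi by simp
      qed
    qed
    moreover have "finite ?A" by simp
    moreover have "k \<notin> h ` ?A" by (auto simp: h_def)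
    moreover have "card (h ` ?A) = card ?A"
      by (intro card_image) (auto simp: inj_on_def h_def split: if_splits)
    ultimately have "larger_before (insert_max m k \<sigma>) i = larger_before \<sigma> (i - 1) + 1"
      by (simp add: larger_before_def)
    with 3 show ?thesis by simp
  qed
qed

text \<open>Canonical words are reduced because the factor \<open>s\<^sub>m \<cdots> s\<^sub>k\<close> has one letter for each of the
  \<open>m + 1 - k\<close> entries that end up to the right of the new maximum, and these give exactly the new
  inversions.\<close>

lemma length_canonical_presentation:
  assumes "\<pi> permutes {1..m}"
  shows "length (canonical_presentation m \<pi>) = (\<Sum>i = 1..m. larger_before \<pi> i)"
  using assms
proof (induction m arbitrary: \<pi>)
  case 0
  then show ?case
    using permutes_le_1[OF 0] canonical_presentation_trivial[of 0] by simp
next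
  case (Suc m)
  then obtain \<sigma> k where \<sigma>: "\<sigma> permutes {1..m}" "1 \<le> k" "k \<le> m + 1" "\<pi> = insert_max m k \<sigma>"
    using insert_max_cases[of \<pi> m] by auto
  let ?c = "larger_before \<pi>" and ?d = "larger_before \<sigma>"
  note rec = larger_before_insert_max[OF \<sigma>(1-3), folded \<sigma>(4)]
  have "(\<Sum>i = 1..m + 1. ?c i) = (\<Sum>i\<in>{1..<k}. ?c i) + ?c k + (\<Sum>i\<in>{Suc k..<Suc (m + 1)}. ?c i)"
  proof -
    have "{1..m + 1} = {1..<k} \<union> ({k} \<union> {Suc k..<Suc (m + 1)})"
      using \<sigma>(2,3) by auto
    then show ?thesis
      by (simp only:) (subst sum.union_disjoint; auto)+
  qed
  also have "(\<Sum>i\<in>{Suc k..<Suc (m + 1)}. ?c i) = (\<Sum>i\<in>{k..<m + 1}. ?c (Suc i))"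
    by (rule sum.shift_bounds_Suc_ivl)
  also have "\<dots> = (\<Sum>i\<in>{k..<m + 1}. ?d i + 1)"
    using rec \<sigma>(2) by (intro sum.cong) auto
  also have "\<dots> = (\<Sum>i\<in>{k..<m + 1}. ?d i) + (m + 1 - k)"
    by (subst sum.distrib) simp
  also have "(\<Sum>i\<in>{1..<k}. ?c i) = (\<Sum>i\<in>{1..<k}. ?d i)"
    using rec \<sigma>(3) by (intro sum.cong) auto
  also have "?c k = 0"
    using rec \<sigma>(2,3) by simp
  also have "(\<Sum>i\<in>{1..<k}. ?d i) + 0 + ((\<Sum>i\<in>{k..<m + 1}. ?d i) + (m + 1 - k)) =
      (\<Sum>i\<in>{1..<m + 1}. ?d i) + (m + 1 - k)"
    using sum.atLeastLessThan_concat[OF \<sigma>(2,3), of ?d] by linarith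
  also have "(\<Sum>i\<in>{1..<m + 1}. ?d i) = (\<Sum>i = 1..m. ?d i)"
    by (intro sum.cong) auto
  also have "\<dots> + (m + 1 - k) = length (canonical_presentation (m + 1) \<pi>)"
    using Suc.IH[OF \<sigma>(1)] insert_max_permutes_presentation(2)[OF \<sigma>(1-3)] \<sigma>(4)
    by (simp del: upt_Suc)
  finally show ?case by simp
qed

section \<open>The statistics in terms of truncated inversion numbers\<close>

definition code :: "nat \<Rightarrow> (nat \<Rightarrow> nat) \<Rightarrow> nat \<Rightarrow> nat" where
  "code p \<pi> i = min (i - p) (larger_before \<pi> i)"

lemma inv_stat_eq_code: "inv_stat p m \<pi> = (\<Sum>i = p + 1..m. code p \<pi> i)"
  by (simp add: inv_stat_def code_def larger_before_def)

lemma code_1: "code 1 \<pi> i = larger_before \<pi> i"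
  using larger_before_le[of \<pi> i] by (simp add: code_def)

lemma Del_eq_code:
  assumes "inj \<pi>" "1 \<le> p"
  shows "Del p m \<pi> = {i. p + 1 \<le> i \<and> i \<le> m \<and> code p \<pi> i = i - p}"
proof -
  have "card {j. 1 \<le> j \<and> j < i \<and> \<pi> j < \<pi> i} \<le> p - 1 \<longleftrightarrow> code p \<pi> i = i - p" if "p + 1 \<le> i" for i
  proof -
    let ?S = "{j. 1 \<le> j \<and> j < i \<and> \<pi> j < \<pi> i}" and ?L = "{j. 1 \<le> j \<and> j < i \<and> \<pi> j > \<pi> i}"
    have "\<pi> j \<noteq> \<pi> i" if "j < i" for j
      using that injD[OF assms(1), of j i] by auto
    then have "?S \<union> ?L = {1..<i}"
      by fastforce
    moreover have "card (?S \<union> ?L) = card ?S + card ?L"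
      by (intro card_Un_disjoint) auto
    ultimately have "card ?S + larger_before \<pi> i = i - 1"
      by (simp add: larger_before_def)
    with that assms(2) show ?thesis
      by (auto simp: code_def min_def)
  qed
  then show ?thesis
    unfolding Del_def by blast
qed

text \<open>At a descent, \<open>i + 1\<close> inherits all entries larger than \<open>\<pi> i\<close> and gains \<open>\<pi> i\<close> itself; at an
  ascent, \<open>\<pi> i\<close> does not count and the threshold has only risen.\<close>

lemma larger_before_less_Suc_iff:
  assumes "inj \<pi>" "1 \<le> i"
  shows "larger_before \<pi> i < larger_before \<pi> (i + 1) \<longleftrightarrow> \<pi> i > \<pi> (i + 1)"
proof (cases "\<pi> i > \<pi> (i + 1)")
  case True
  let ?L = "{j. 1 \<le> j \<and> j < i \<and> \<pi> j > \<pi> i}"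
  have "card (insert i ?L) \<le> card {j. 1 \<le> j \<and> j < i + 1 \<and> \<pi> j > \<pi> (i + 1)}"
    using True assms(2) by (intro card_mono) auto
  with True show ?thesis
    by (simp add: larger_before_def)
next
  case False
  then have "\<pi> i < \<pi> (i + 1)"
    using injD[OF assms(1), of i "i + 1"] by fastforce
  then have "larger_before \<pi> (i + 1) \<le> larger_before \<pi> i"
    unfolding larger_before_def by (intro card_mono) (auto simp: less_Suc_eq)
  with False show ?thesis by simp
qed

text \<open>If \<open>i + 1\<close> lies outside \<open>Del\<^sub>p\<close>, its inversion number is at most \<open>i - p\<close>, so comparing it with
  that of \<open>i\<close> gives the same answer before and after truncation. If \<open>i + 1\<close> lies in \<open>Del\<^sub>p\<close>, its
  truncated number \<open>i + 1 - p\<close> exceeds the bound \<open>i - p\<close> for the one of \<open>i\<close>.\<close>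

lemma Des_eq_code:
  assumes "inj \<pi>" "1 \<le> p"
  shows "Des p m \<pi> = {i. p \<le> i \<and> i + 1 \<le> m \<and> code p \<pi> i < code p \<pi> (i + 1)}"
proof -
  have "\<pi> i > \<pi> (i + 1) \<or> code p \<pi> (i + 1) = i + 1 - p \<longleftrightarrow> code p \<pi> i < code p \<pi> (i + 1)"
    if "p \<le> i" for i
  proof -
    have "\<pi> i > \<pi> (i + 1) \<longleftrightarrow> larger_before \<pi> i < larger_before \<pi> (i + 1)"
      using larger_before_less_Suc_iff[of \<pi> i] assms that by simp
    with that show ?thesis
      by (auto simp: code_def min_def)
  qed
  then show ?thesis
    using assms(2) unfolding Des_def Del_eq_code[OF assms] by auto
qed

lemma inv_stat_1_eq_ell_1:
  assumes "\<pi> permutes {1..m}"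
  shows "inv_stat 1 m \<pi> = ell 1 m \<pi>"
proof -
  have "\<forall>i\<in>set (canonical_presentation m \<pi>). 1 \<le> i"
    using canonical_presentation_range[OF assms] by auto
  then have "ell 1 m \<pi> = length (canonical_presentation m \<pi>)"
    by (simp add: ell_def)
  also have "\<dots> = (\<Sum>i = 1..m. larger_before \<pi> i)"
    by (rule length_canonical_presentation[OF assms])
  also have "\<dots> = (\<Sum>i = 1 + 1..m. larger_before \<pi> i)"
    using larger_before_le[of \<pi> 1]
    by (intro sum.mono_neutral_right) (auto simp: not_le less_Suc_eq_le le_antisym)
  finally show ?thesis
    by (simp only: inv_stat_eq_code code_1)
qed

section \<open>The effect of the map on insertions\<close>

definition lower_word :: "nat \<Rightarrow> nat list \<Rightarrow> nat list" where
  "lower_word q w = map (\<lambda>j. j - q + 1) (filter (\<lambda>j. q \<le> j) w)"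

lemma perm_prod_f_gen: "perm_prod (map (f_gen q) w) = perm_prod (map adj (lower_word q w))"
  by (induction w) (auto simp: f_gen_def lower_word_def)

lemma lower_word_append: "lower_word q (v @ w) = lower_word q v @ lower_word q w"
  by (simp add: lower_word_def)

lemma lower_word_down:
  assumes "1 \<le> q" "k \<le> n + q"
  shows "lower_word q (rev [k..<n + q]) = rev [max k q - q + 1..<n + 1]"
  using assms(2)
proof (induction n)
  case 0
  with assms(1) show ?case
    by (auto simp: lower_word_def filter_empty_conv)
next
  case (Suc n)
  show ?case
  proof (cases "k = Suc n + q")
    case True
    then show ?thesis by (simp add: lower_word_def)
  next
    case False
    with Suc.prems have k: "k \<le> n + q" by simp
    then have "rev [k..<Suc n + q] = (n + q) # rev [k..<n + q]" by simp
    then have "lower_word q (rev [k..<Suc n + q]) = (n + 1) # lower_word q (rev [k..<n + q])"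
      by (simp add: lower_word_def del: upt_Suc)
    also have "\<dots> = rev [max k q - q + 1..<Suc n + 1]"
      using Suc.IH[OF k] k by simp
    finally show ?thesis .
  qed
qed

text \<open>Of the letters \<open>m, \<dots>, k\<close> of the new factor, those below \<open>q\<close> disappear. What survives is again a
  descending run, now from \<open>n\<close> down to \<open>max k q - q + 1\<close>; for \<open>k \<le> q\<close> this inserts the maximum in front.\<close>

lemma f_map_insert_max:
  assumes "\<sigma> permutes {1..n + q - 1}" "1 \<le> q" "1 \<le> k" "k \<le> n + q"
  shows "f_map q (n + q) (insert_max (n + q - 1) k \<sigma>) =
    insert_max n (max k q - q + 1) (f_map q (n + q - 1) \<sigma>)"
proof -
  have "canonical_presentation (n + q) (insert_max (n + q - 1) k \<sigma>) =
      canonical_presentation (n + q - 1) \<sigma> @ rev [k..<n + q]"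
    using insert_max_permutes_presentation(2)[OF assms(1), of k] assms by simp
  then show ?thesis
    using lower_word_down[OF assms(2,4)]
    by (simp add: f_map_def insert_max_def perm_prod_append perm_prod_f_gen del: upt_Suc)
qed

text \<open>Both facts are proved by one induction, since each step of the map on permutations is described
  by the same insertion position. The induction can start with the group \<open>S\<^bsub>q-1\<^esub>\<close>, all of whose
  generators are sent to the identity.\<close>

lemma f_map_presentation_code:
  assumes "\<pi> permutes {1..n + q - 1}" "1 \<le> q"
  shows "f_map q (n + q - 1) \<pi> permutes {1..n} \<and>
    canonical_presentation n (f_map q (n + q - 1) \<pi>) =
      lower_word q (canonical_presentation (n + q - 1) \<pi>) \<and>
    (\<forall>i\<in>{1..n}. larger_before (f_map q (n + q - 1) \<pi>) i = code q \<pi> (i + q - 1))"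
  using assms(1)
proof (induction n arbitrary: \<pi>)
  case 0
  have "lower_word q (canonical_presentation (q - 1) \<pi>) = []"
    using canonical_presentation_range[OF 0] by (force simp: lower_word_def filter_empty_conv)
  moreover from this have "f_map q (q - 1) \<pi> = id"
    by (simp add: f_map_def perm_prod_f_gen)
  ultimately show ?case
    using canonical_presentation_trivial[of 0] permutes_id[of "{1..0::nat}"] by (simp add: id_def)
next
  case (Suc n)
  define m where "m = n + q - 1"
  have m: "m + 1 = n + q" "Suc n + q - 1 = m + 1"
    using assms(2) by (simp_all add: m_def)
  obtain \<sigma> k where \<sigma>: "\<sigma> permutes {1..m}" "1 \<le> k" "k \<le> m + 1" "\<pi> = insert_max m k \<sigma>"
    using insert_max_cases[of \<pi> m] Suc.prems m(2) by metis
  define k' \<tau> where "k' = max k q - q + 1" and "\<tau> = f_map q m \<sigma>"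
  have k': "1 \<le> k'" "k' \<le> n + 1"
    using \<sigma>(3) m(1) by (auto simp: k'_def)
  have IH: "\<tau> permutes {1..n}"
      "canonical_presentation n \<tau> = lower_word q (canonical_presentation m \<sigma>)"
      "\<And>i. 1 \<le> i \<Longrightarrow> i \<le> n \<Longrightarrow> larger_before \<tau> i = code q \<sigma> (i + q - 1)"
    using Suc.IH[of \<sigma>] \<sigma>(1) by (auto simp: \<tau>_def m_def)
  have f: "f_map q (m + 1) \<pi> = insert_max n k' \<tau>"
    using f_map_insert_max[of \<sigma> n q k] \<sigma> assms(2) m(1) by (simp add: \<tau>_def k'_def m_def)
  note ins = insert_max_permutes_presentation[OF IH(1) k']
  have "canonical_presentation (n + 1) (insert_max n k' \<tau>) =
      lower_word q (canonical_presentation (m + 1) \<pi>)"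
    unfolding ins(2) \<sigma>(4) insert_max_permutes_presentation(2)[OF \<sigma>(1-3)] lower_word_append IH(2)
    using lower_word_down[OF assms(2), of k n] \<sigma>(3) m(1) by (simp add: k'_def del: upt_Suc)
  moreover have "larger_before (insert_max n k' \<tau>) i = code q \<pi> (i + q - 1)"
    if i: "1 \<le> i" "i \<le> n + 1" for i
  proof -
    let ?I = "i + q - 1"
    have I: "1 \<le> ?I" "?I \<le> m + 1"
      using i assms(2) m(1) by auto
    note \<tau>_rec = larger_before_insert_max[OF IH(1) k' i]
    note \<sigma>_rec = larger_before_insert_max[OF \<sigma>(1-3) I, folded \<sigma>(4)]
    consider "i < k'" | "i = k'" | "k' < i" by linarith
    then show ?thesis
    proof cases
      case 1
      then have "?I < k" using assms(2) i by (auto simp: k'_def max_def split: if_splits)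
      with 1 IH(3)[of i] i k' \<tau>_rec \<sigma>_rec show ?thesis by (simp add: code_def)
    next
      case 2
      \<comment> \<open>Either \<open>q \<le> k\<close> and the new maximum stands at this position, or \<open>k < q\<close> and the position is
        \<open>q\<close>, where truncation gives \<open>0\<close>.\<close>
      then have "?I = k \<or> ?I = q" using assms(2) by (auto simp: k'_def)
      then have "code q \<pi> ?I = 0" using \<sigma>_rec by (auto simp: code_def)
      with 2 \<tau>_rec show ?thesis by simp
    next
      case 3
      then have "k < ?I" "q < ?I" using assms(2) k' by (auto simp: k'_def)
      then have "larger_before \<pi> ?I = larger_before \<sigma> (?I - 1) + 1"
        using \<sigma>_rec by simp
      then have "code q \<pi> ?I = code q \<sigma> (?I - 1) + 1"
        unfolding code_def using \<open>q < ?I\<close> by arith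
      also have "code q \<sigma> (?I - 1) = larger_before \<tau> (i - 1)"
        using IH(3)[of "i - 1"] 3 i k' by simp
      finally show ?thesis using 3 \<tau>_rec by simp
    qed
  qed
  ultimately show ?case
    using ins(1) f unfolding m(2) by simp
qed

section \<open>Comparison of the statistics\<close>

lemma shift_set_eq_image:
  assumes "1 \<le> q" "\<And>i. i \<in> D \<Longrightarrow> q \<le> i" "\<And>i. 1 \<le> i \<Longrightarrow> i \<in> E \<longleftrightarrow> i + q - 1 \<in> D" "0 \<notin> E"
  shows "shift_set D (int q - 1) = int ` E" and "card D = card E"
proof -
  have D: "D = (\<lambda>i. i + q - 1) ` E"
  proof (intro equalityI subsetI)
    fix d assume "d \<in> D"
    with assms(2) have "q \<le> d" by blast
    with \<open>d \<in> D\<close> assms(1) assms(3)[of "d - q + 1"] have "d - q + 1 \<in> E" by simp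
    with \<open>q \<le> d\<close> show "d \<in> (\<lambda>i. i + q - 1) ` E" by force
  next
    fix d assume "d \<in> (\<lambda>i. i + q - 1) ` E"
    then obtain i where "i \<in> E" "d = i + q - 1" by blast
    moreover from this assms(4) have "1 \<le> i" by (cases i) auto
    ultimately show "d \<in> D" using assms(3) by blast
  qed
  then have "shift_set D (int q - 1) = (\<lambda>i. int (i + q - 1) - (int q - 1)) ` E"
    by (auto simp: shift_set_def)
  also have "\<dots> = int ` E"
    using assms(1) by (intro image_cong) auto
  finally show "shift_set D (int q - 1) = int ` E" .
  show "card D = card E"
    unfolding D using assms(1) by (intro card_image) (auto simp: inj_on_def)
qed

theorem proposition8p6:
  fixes n q :: nat and \<pi> :: "nat \<Rightarrow> nat"
  assumes "n \<ge> 1" and "q \<ge> 1"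
    and "\<pi> permutes {1..n + q - 1}"
  shows
    "(shift_set (Del q (n + q - 1) \<pi>) (int q - 1) = int ` Del 1 n (f_map q (n + q - 1) \<pi>) \<and>
      del q (n + q - 1) \<pi> = del 1 n (f_map q (n + q - 1) \<pi>)) \<and>
     (shift_set (Des q (n + q - 1) \<pi>) (int q - 1) = int ` Des 1 n (f_map q (n + q - 1) \<pi>) \<and>
      des q (n + q - 1) \<pi> = des 1 n (f_map q (n + q - 1) \<pi>)) \<and>
     (inv_stat q (n + q - 1) \<pi> = inv_stat 1 n (f_map q (n + q - 1) \<pi>) \<and>
      inv_stat 1 n (f_map q (n + q - 1) \<pi>) = ell q (n + q - 1) \<pi> \<and>
      ell q (n + q - 1) \<pi> = ell 1 n (f_map q (n + q - 1) \<pi>))"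
proof -
  define m where "m = n + q - 1"
  define \<rho> where "\<rho> = f_map q m \<pi>"
  have m: "m + 1 = n + q"
    using assms(2) by (simp add: m_def)
  have \<rho>: "\<rho> permutes {1..n}"
      "canonical_presentation n \<rho> = lower_word q (canonical_presentation m \<pi>)"
    and code: "\<And>i. 1 \<le> i \<Longrightarrow> i \<le> n \<Longrightarrow> code 1 \<rho> i = code q \<pi> (i + q - 1)"
    using f_map_presentation_code[OF assms(3,2)] unfolding \<rho>_def m_def code_1 by auto
  have inj: "inj \<pi>" "inj \<rho>"
    using permutes_inj assms(3) \<rho>(1) by blast+
  note Del_\<pi> = Del_eq_code[OF inj(1) assms(2)] and Del_\<rho> = Del_eq_code[OF inj(2) le_refl]
  note Des_\<pi> = Des_eq_code[OF inj(1) assms(2)] and Des_\<rho> = Des_eq_code[OF inj(2) le_refl]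

  have Del_iff: "i \<in> Del 1 n \<rho> \<longleftrightarrow> i + q - 1 \<in> Del q m \<pi>" if "1 \<le> i" for i
    using that code[of i] assms(2) m unfolding Del_\<pi> Del_\<rho> by auto
  have Del: "shift_set (Del q m \<pi>) (int q - 1) = int ` Del 1 n \<rho>"
    by (rule shift_set_eq_image(1)[OF assms(2) _ Del_iff]) (auto simp: Del_def)

  have Des_iff: "i \<in> Des 1 n \<rho> \<longleftrightarrow> i + q - 1 \<in> Des q m \<pi>" if "1 \<le> i" for i
  proof (cases "i + 1 \<le> n")
    case True
    moreover have "i + 1 + q - 1 = i + q - 1 + 1" using assms(2) by simp
    ultimately show ?thesis
      using that code[of i] code[of "i + 1"] assms(2) m unfolding Des_\<pi> Des_\<rho> by auto
  next
    case False
    then show ?thesis using m unfolding Des_\<pi> Des_\<rho> by auto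
  qed
  have Des: "shift_set (Des q m \<pi>) (int q - 1) = int ` Des 1 n \<rho>"
      "card (Des q m \<pi>) = card (Des 1 n \<rho>)"
    by (rule shift_set_eq_image[OF assms(2) _ Des_iff]; auto simp: Des_def)+

  have "count_list (lower_word q w) 1 = count_list w q" for w
    by (induction w) (auto simp: lower_word_def)
  then have del: "del q m \<pi> = del 1 n \<rho>"
    by (simp only: del_def \<rho>(2))

  have "filter (\<lambda>i. 1 \<le> i) (lower_word q w) = lower_word q w" for w
    by (auto simp: lower_word_def filter_id_conv)
  then have ell: "ell q m \<pi> = ell 1 n \<rho>"
    by (simp only: ell_def \<rho>(2)) (simp add: lower_word_def)

  have "inv_stat q m \<pi> = (\<Sum>i = 1 + 1..n. code q \<pi> (i + q - 1))"
    unfolding inv_stat_eq_code using assms(2) m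
    by (intro sum.reindex_bij_witness[of _ "\<lambda>i. i + q - 1" "\<lambda>i. i - q + 1"]) auto
  also have "\<dots> = inv_stat 1 n \<rho>"
    unfolding inv_stat_eq_code using code by (intro sum.cong) auto
  finally have "inv_stat q m \<pi> = inv_stat 1 n \<rho>" .
  then show ?thesis
    using Del Des del ell inv_stat_1_eq_ell_1[OF \<rho>(1)]
    unfolding des_def m_def[symmetric] \<rho>_def[symmetric] by simp
qed

end
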